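(* The only pair of positive integers $(x,y)$ with $y > x$ satisfying $$(y-x)^{x+y} = x^y$$ is $(x,y) = (1,2)$. *)

theory Defs
  imports Main
begin

end

(* Put d = y - x, so that d^(2x+d) = x^(x+d). Then d^(x+d) divides x^(x+d), hence x = k d;
   cancelling and taking d-th roots gives d^k = k^(k+1). Now k^k divides d^k, hence d = m k;
   cancelling again gives m^k = k, which is less than 2^k, so m = 1. *)
theory Submission
  imports Defs
begin

lemma pow_eq_pow_Suc_self_imp_one:
  fixes d k :: nat
  assumes "0 < k" and eq: "d ^ k = k ^ Suc k"
  shows "d = 1 \<and> k = 1"
proof -
  have "k ^ k dvd d ^ k"
    by (simp add: eq)
  then have "k dvd d"
    using \<open>0 < k\<close> by (simp add: pow_divides_pow_iff)
  then obtain m where m: "d = k * m" ..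
  have mk: "m ^ k = k"
    using eq \<open>0 < k\<close> by (simp add: m power_mult_distrib)
  have "m < 2"
  proof (rule ccontr)
    assume "\<not> m < 2"
    then have "2 ^ k \<le> m ^ k"
      by (intro power_mono) auto
    then show False
      using less_exp [of k] mk by linarith
  qed
  moreover have "m \<noteq> 0"
    using mk \<open>0 < k\<close> by (metis less_irrefl zero_power)
  ultimately have "m = 1"
    by linarith
  then show ?thesis
    using m mk by simp
qed

text \<open>Here \<open>x + d\<close> stands for \<open>y\<close>. Grouping \<open>x + y\<close> as
  \<open>x + (x + d)\<close> exposes the factor \<open>d ^ (x + d)\<close>, which has the same
  exponent as the right-hand side.\<close>

lemma pow_add_eq_pow_imp:
  fixes d x :: nat
  assumes "0 < d" "0 < x" and eq: "d ^ (x + (x + d)) = x ^ (x + d)"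
  shows "d = 1 \<and> x = 1"
proof -
  have "d ^ (x + d) dvd x ^ (x + d)"
    unfolding eq [symmetric] by (rule le_imp_power_dvd) simp
  then have "d dvd x"
    using \<open>0 < d\<close> by (simp add: pow_divides_pow_iff)
  then obtain k where k: "x = d * k" ..
  have "0 < k"
    using \<open>0 < x\<close> k by simp
  have "d ^ x * d ^ (x + d) = k ^ (x + d) * d ^ (x + d)"
  proof -
    have "d ^ x * d ^ (x + d) = x ^ (x + d)"
      using eq by (simp only: power_add)
    also have "\<dots> = (k * d) ^ (x + d)"
      by (simp only: k mult.commute)
    finally show ?thesis
      by (simp only: power_mult_distrib)
  qed
  then have "d ^ x = k ^ (x + d)"
    using \<open>0 < d\<close> by simp
  \<comment> \<open>Both exponents are multiples of \<open>d\<close>, so each side is a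
    \<open>d\<close>-th power and the root can be taken.\<close>
  moreover have "x = k * d" "x + d = Suc k * d"
    by (simp_all add: k)
  ultimately have "(d ^ k) ^ d = (k ^ Suc k) ^ d"
    by (simp only: power_mult)
  then have "d ^ k = k ^ Suc k"
    by (rule power_eq_imp_eq_base) (use \<open>0 < d\<close> in simp_all)
  with \<open>0 < k\<close> have "d = 1 \<and> k = 1"
    by (rule pow_eq_pow_Suc_self_imp_one)
  then show ?thesis
    using k by simp
qed

theorem mainTheorem10:
  "{(x :: nat, y :: nat). 0 < x \<and> 0 < y \<and> x < y \<and> (y - x) ^ (x + y) = x ^ y} = {(1, 2)}"
proof -
  have "x = 1 \<and> y = 2" if "0 < x" "x < y" "(y - x) ^ (x + y) = x ^ y" for x y :: nat
    \<comment> \<open>As \<open>x < y\<close>, truncated subtraction is exact: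
      \<open>x + (y - x) = y\<close>.\<close>
    using pow_add_eq_pow_imp [of "y - x" x] that by auto
  then show ?thesis
    \<comment> \<open>The converse inclusion is the check \<open>1 ^ 3 = 1 ^ 2\<close>.\<close>
    by auto
qed

end
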